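(* Let $m,n,r$ be positive integers, $L>0$, $\eta>0$, and let $\ell:\mathbb{R}^{m\times n}\to\mathbb{R}$ be differentiable with $L$-Lipschitz gradient, i.e. $\|\nabla\ell(\mathbf{W})-\nabla\ell(\mathbf{W}')\|_{\mathrm F}\le L\|\mathbf{W}-\mathbf{W}'\|_{\mathrm F}$ for all $\mathbf{W},\mathbf{W}'\in\mathbb{R}^{m\times n}$. Let $\mathbf{W}_t\in\mathbb{R}^{m\times n}$, $\mathbf{A}_t\in\mathbb{R}^{m\times r}$, $\mathbf{B}_t\in\mathbb{R}^{n\times r}$ satisfy $\|\mathbf{A}_t^\top\nabla\ell(\mathbf{W}_t)\|_{\mathrm F}\,\|\nabla\ell(\mathbf{W}_t)\mathbf{B}_t\|_{\mathrm F}\neq 0$. Define $$C_t^A:=\|\mathbf{A}_t^\top\nabla\ell(\mathbf{W}_t)\|_{\mathrm F}^2\,\|\nabla\ell(\mathbf{W}_t)\mathbf{B}_t\mathbf{B}_t^\top\|_{\mathrm F}^2-\|\nabla\ell(\mathbf{W}_t)\mathbf{B}_t\|_{\mathrm F}^2\,\|\mathbf{A}_t^\top\nabla\ell(\mathbf{W}_t)\mathbf{B}_t\|_{\mathrm F}^2,$$ $$C_t^B:=\|\nabla\ell(\mathbf{W}_t)\mathbf{B}_t\|_{\mathrm F}^2\,\|\mathbf{A}_t\mathbf{A}_t^\top\nabla\ell(\mathbf{W}_t)\|_{\mathrm F}^2-\|\mathbf{A}_t^\top\nabla\ell(\mathbf{W}_t)\|_{\mathrm F}^2\,\|\mathbf{A}_t^\top\nabla\ell(\mathbf{W}_t)\mathbf{B}_t\|_{\mathrm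 F}^2,$$ $$C_t:=\|\mathbf{A}_t\mathbf{A}_t^\top\nabla\ell(\mathbf{W}_t)\|_{\mathrm F}^2\,\|\nabla\ell(\mathbf{W}_t)\mathbf{B}_t\mathbf{B}_t^\top\|_{\mathrm F}^2-\|\mathbf{A}_t^\top\nabla\ell(\mathbf{W}_t)\mathbf{B}_t\|_{\mathrm F}^4.$$ Then a global minimizer over $(\alpha_t,\beta_t)\in\mathbb{R}^2$ of $$\frac{L}{2}\Big\|\frac{1}{L}\nabla\ell(\mathbf{W}_t)-\eta\beta_t^2\,\nabla\ell(\mathbf{W}_t)\mathbf{B}_t\mathbf{B}_t^\top-\eta\alpha_t^2\,\mathbf{A}_t\mathbf{A}_t^\top\nabla\ell(\mathbf{W}_t)\Big\|_{\mathrm F}^2$$ is given (for any choice of signs) by $$(\alpha_t^*,\beta_t^* )=\begin{cases}\Big(\pm\dfrac{\|\mathbf{A}_t^\top\nabla\ell(\mathbf{W}_t)\|_{\mathrm F}}{\sqrt{L\eta}\,\|\mathbf{A}_t\mathbf{A}_t^\top\nabla\ell(\mathbf{W}_t)\|_{\mathrm F}},\,0\Big), & \text{if } (C_t^A>0 \text{ and } C_t^B\le 0), \text{ or } (C_t=0 \text{ and } \mathbf{A}_t\neq\mathbf{0}),\\[2ex] \Big(0,\,\pm\dfrac{\|\nabla\ell(\mathbf{W}_t)\mathbf{B}_t\|_{\mathrm F}}{\sqrt{L\eta}\,\|\nabla\ell(\mathbf{W}_t)\mathbf{B}_t\mathbf{B}_t^\top\|_{\mathrm F}}\Big), & \text{if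 } (C_t^A\le 0 \text{ and } C_t^B>0), \text{ or } (C_t=0 \text{ and } \mathbf{B}_t\neq\mathbf{0}),\\[2ex] \Big(\pm\sqrt{\dfrac{C_t^A}{L\eta C_t}},\,\pm\sqrt{\dfrac{C_t^B}{L\eta C_t}}\Big), & \text{if } C_t^A\ge 0,\ C_t^B\ge 0 \text{ and } C_t>0.\end{cases}$$ Where the conditions of several cases hold at once, each corresponding formula gives a global minimizer.
   Context: $\|\cdot\|_{\mathrm F}$ is the Frobenius norm. In the paper, $\mathbf{W}_t$ is the weight matrix at optimization step $t$, $\mathbf{A}_t,\mathbf{B}_t$ are the low-rank adapters, $\eta$ is the learning rate, and the objective arises from replacing $(\mathbf{A}_t,\mathbf{B}_t)$ by the scaled adapters $(\alpha_t\mathbf{A}_t,\beta_t\mathbf{B}_t)$. *)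

theory Defs
  imports "HOL-Analysis.Analysis"
begin

text \<open>
  An \<open>m \<times> n\<close> matrix is an element of \<open>real ^ 'n ^ 'm\<close>. The library's norm and inner product on
  this type are the Frobenius ones, so \<open>GDERIV\<close> on it yields the usual matrix gradient.
\<close>

lemma norm_matrix_eq_frobenius:
  fixes M :: "real ^ 'n ^ 'm"
  shows "norm M = sqrt (\<Sum>i\<in>UNIV. \<Sum>j\<in>UNIV. (M $ i $ j)\<^sup>2)"
  by (simp add: norm_vec_def L2_set_def sum_nonneg)

text \<open>In the definitions below, \<open>G\<close> stands for the gradient of the loss at the current weights.\<close>

definition C_A :: "real ^ 'n ^ 'm \<Rightarrow> real ^ 'r ^ 'm \<Rightarrow> real ^ 'r ^ 'n \<Rightarrow> real" where
  "C_A G A B =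
     (norm (transpose A ** G))\<^sup>2 * (norm (G ** B ** transpose B))\<^sup>2
     - (norm (G ** B))\<^sup>2 * (norm (transpose A ** G ** B))\<^sup>2"

definition C_B :: "real ^ 'n ^ 'm \<Rightarrow> real ^ 'r ^ 'm \<Rightarrow> real ^ 'r ^ 'n \<Rightarrow> real" where
  "C_B G A B =
     (norm (G ** B))\<^sup>2 * (norm (A ** transpose A ** G))\<^sup>2
     - (norm (transpose A ** G))\<^sup>2 * (norm (transpose A ** G ** B))\<^sup>2"

definition C_AB :: "real ^ 'n ^ 'm \<Rightarrow> real ^ 'r ^ 'm \<Rightarrow> real ^ 'r ^ 'n \<Rightarrow> real" where
  "C_AB G A B =
     (norm (A ** transpose A ** G))\<^sup>2 * (norm (G ** B ** transpose B))\<^sup>2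
     - (norm (transpose A ** G ** B)) ^ 4"

definition scaling_objective ::
  "real \<Rightarrow> real \<Rightarrow> real ^ 'n ^ 'm \<Rightarrow> real ^ 'r ^ 'm \<Rightarrow> real ^ 'r ^ 'n \<Rightarrow> real \<times> real \<Rightarrow> real" where
  "scaling_objective L \<eta> G A B = (\<lambda>(\<alpha>, \<beta>).
     L / 2 * (norm ((1 / L) *\<^sub>R G
                    - (\<eta> * \<beta>\<^sup>2) *\<^sub>R (G ** B ** transpose B)
                    - (\<eta> * \<alpha>\<^sup>2) *\<^sub>R (A ** transpose A ** G)))\<^sup>2)"

text \<open>Minimality over the whole plane, i.e. \<open>is_arg_min\<close> with the trivial constraint.\<close>

abbreviation is_global_min :: "('a \<Rightarrow> real) \<Rightarrow> 'a \<Rightarrow> bool" where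
  "is_global_min f x \<equiv> is_arg_min f (\<lambda>_. True) x"

end

theory Submission
  imports Defs
begin

text \<open>
  Put \<open>U = A A\<^sup>T G\<close> and \<open>V = G B B\<^sup>T\<close>. Then \<open>\<langle>G, U\<rangle> = \<parallel>A\<^sup>T G\<parallel>\<^sup>2\<close>, \<open>\<langle>G, V\<rangle> = \<parallel>G B\<parallel>\<^sup>2\<close> and
  \<open>\<langle>U, V\<rangle> = \<parallel>A\<^sup>T G B\<parallel>\<^sup>2\<close>, so with \<open>x = \<eta> \<alpha>\<^sup>2\<close> and \<open>y = \<eta> \<beta>\<^sup>2\<close> the problem is to project \<open>G / L\<close> onto the
  convex cone spanned by \<open>U\<close> and \<open>V\<close>. A point of the cone is optimal as soon as the residual has
  nonpositive inner product with both generators and is orthogonal to those actually used; up to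
  positive factors, \<open>C_A\<close> and \<open>C_B\<close> are these inner products at the optimal points on the
  two rays, and \<open>C_AB\<close> is the Gram determinant of \<open>U\<close> and \<open>V\<close>.
\<close>

lemma inner_matrix_mult_left:
  fixes M :: "real ^ 'n ^ 'm" and N :: "real ^ 'k ^ 'n" and P :: "real ^ 'k ^ 'm"
  shows "(M ** N) \<bullet> P = N \<bullet> (transpose M ** P)"
proof -
  have "(M ** N) \<bullet> P = (\<Sum>i\<in>UNIV. \<Sum>j\<in>UNIV. \<Sum>l\<in>UNIV. M $ i $ l * N $ l $ j * P $ i $ j)"
    by (simp add: inner_vec_def matrix_matrix_mult_def sum_distrib_right)
  also have "\<dots> = (\<Sum>i\<in>UNIV. \<Sum>l\<in>UNIV. \<Sum>j\<in>UNIV. M $ i $ l * N $ l $ j * P $ i $ j)"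
    by (intro sum.cong refl sum.swap)
  also have "\<dots> = (\<Sum>l\<in>UNIV. \<Sum>i\<in>UNIV. \<Sum>j\<in>UNIV. M $ i $ l * N $ l $ j * P $ i $ j)"
    by (rule sum.swap)
  also have "\<dots> = (\<Sum>l\<in>UNIV. \<Sum>j\<in>UNIV. \<Sum>i\<in>UNIV. M $ i $ l * N $ l $ j * P $ i $ j)"
    by (intro sum.cong refl sum.swap)
  also have "\<dots> = N \<bullet> (transpose M ** P)"
    by (simp add: inner_vec_def matrix_matrix_mult_def transpose_def sum_distrib_left mult_ac)
  finally show ?thesis .
qed

lemma inner_transpose: "transpose M \<bullet> transpose N = (M :: real ^ 'n ^ 'm) \<bullet> N"
  unfolding inner_vec_def transpose_def by (simp, rule sum.swap)

lemma inner_matrix_mult_right: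
  fixes M :: "real ^ 'n ^ 'm" and N :: "real ^ 'k ^ 'n" and P :: "real ^ 'k ^ 'm"
  shows "(M ** N) \<bullet> P = M \<bullet> (P ** transpose N)"
proof -
  have "(M ** N) \<bullet> P = (transpose N ** transpose M) \<bullet> transpose P"
    by (metis inner_transpose matrix_transpose_mul)
  also have "\<dots> = transpose M \<bullet> (N ** transpose P)"
    by (simp add: inner_matrix_mult_left)
  also have "\<dots> = transpose M \<bullet> transpose (P ** transpose N)"
    by (simp add: matrix_transpose_mul)
  also have "\<dots> = M \<bullet> (P ** transpose N)"
    by (rule inner_transpose)
  finally show ?thesis .
qed

text \<open>Expanding the square of \<open>norm (r - d)\<close> adds
  \<open>d \<bullet> d - 2 * (r \<bullet> d)\<close>, which is nonnegative.\<close>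

lemma norm_le_norm_diff_if_inner_nonpos:
  fixes r d :: "'a :: real_inner"
  assumes "r \<bullet> d \<le> 0"
  shows "norm r \<le> norm (r - d)"
proof -
  have "2 * (r \<bullet> d) \<le> d \<bullet> d"
    using assms inner_ge_zero[of d] by linarith
  then show ?thesis
    by (simp add: norm_le inner_diff_left inner_diff_right inner_commute)
qed

text \<open>Sufficient KKT conditions: the objective is convex in the squares
  \<open>\<alpha>\<^sup>2\<close> and \<open>\<beta>\<^sup>2\<close>, and its partial derivatives in
  them are \<open>- L * \<eta>\<close> times the inner products of the residual \<open>R\<close>
  with the two generators; \<open>slack\<close> is complementary slackness.\<close>

lemma scaling_objective_global_minI:
  fixes G :: "real ^ 'n ^ 'm" and A :: "real ^ 'r ^ 'm" and B :: "real ^ 'r ^ 'n"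
  assumes "L > 0" "\<eta> > 0"
    and R: "R = (1 / L) *\<^sub>R G - (\<eta> * \<beta>\<^sup>2) *\<^sub>R (G ** B ** transpose B)
                - (\<eta> * \<alpha>\<^sup>2) *\<^sub>R (A ** transpose A ** G)"
    and nonpos: "R \<bullet> (A ** transpose A ** G) \<le> 0" "R \<bullet> (G ** B ** transpose B) \<le> 0"
    and slack: "\<alpha>\<^sup>2 * (R \<bullet> (A ** transpose A ** G)) = 0" "\<beta>\<^sup>2 * (R \<bullet> (G ** B ** transpose B)) = 0"
  shows "is_global_min (scaling_objective L \<eta> G A B) (\<alpha>, \<beta>)"
proof -
  let ?U = "A ** transpose A ** G" and ?V = "G ** B ** transpose B"
  have "scaling_objective L \<eta> G A B (\<alpha>, \<beta>) \<le> scaling_objective L \<eta> G A B (a, b)" for a b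
  proof -
    \<comment> \<open>\<open>d\<close> is the change of the approximant on passing to the competitor
      \<open>(a, b)\<close>, whose residual is therefore \<open>R - d\<close>.\<close>
    define d where "d = (\<eta> * (b\<^sup>2 - \<beta>\<^sup>2)) *\<^sub>R ?V + (\<eta> * (a\<^sup>2 - \<alpha>\<^sup>2)) *\<^sub>R ?U"
    have "R \<bullet> d = \<eta> * (b\<^sup>2 * (R \<bullet> ?V) - \<beta>\<^sup>2 * (R \<bullet> ?V)) + \<eta> * (a\<^sup>2 * (R \<bullet> ?U) - \<alpha>\<^sup>2 * (R \<bullet> ?U))"
      by (simp add: d_def inner_add_right algebra_simps)
    also have "\<dots> = \<eta> * (b\<^sup>2 * (R \<bullet> ?V) + a\<^sup>2 * (R \<bullet> ?U))"
      by (simp only: slack) (simp add: algebra_simps)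
    also have "\<dots> \<le> 0"
      using \<open>\<eta> > 0\<close> nonpos by (intro mult_nonneg_nonpos add_nonpos_nonpos) auto
    finally have "norm R \<le> norm (R - d)"
      by (rule norm_le_norm_diff_if_inner_nonpos)
    moreover have "R - d = (1 / L) *\<^sub>R G - (\<eta> * b\<^sup>2) *\<^sub>R ?V - (\<eta> * a\<^sup>2) *\<^sub>R ?U"
      by (simp add: R d_def algebra_simps)
    ultimately have "norm R \<le> norm ((1 / L) *\<^sub>R G - (\<eta> * b\<^sup>2) *\<^sub>R ?V - (\<eta> * a\<^sup>2) *\<^sub>R ?U)"
      by metis
    then show ?thesis
      using \<open>L > 0\<close> by (simp add: scaling_objective_def power_mono flip: R)
  qed
  then show ?thesis
    by (auto simp: is_arg_min_def not_less)
qed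

text \<open>Equality in Cauchy-Schwarz makes \<open>u\<close> and \<open>v\<close> parallel:
  \<open>?w\<close>, which is \<open>u \<bullet> u\<close> times the component of \<open>v\<close>
  orthogonal to \<open>u\<close>, vanishes, and pairing it with \<open>g\<close> gives the
  claim.\<close>

lemma inner_proportional_if_Cauchy_Schwarz_eq:
  fixes g u v :: "'a :: real_inner"
  assumes eq: "(u \<bullet> u) * (v \<bullet> v) = (u \<bullet> v)\<^sup>2"
  shows "(g \<bullet> v) * (u \<bullet> u) = (g \<bullet> u) * (u \<bullet> v)"
proof -
  let ?w = "(u \<bullet> u) *\<^sub>R v - (u \<bullet> v) *\<^sub>R u"
  have "?w \<bullet> ?w = (u \<bullet> u) * ((u \<bullet> u) * (v \<bullet> v) - (u \<bullet> v)\<^sup>2)"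
    by (simp add: inner_diff_left inner_diff_right inner_commute power2_eq_square algebra_simps)
  then have "?w = 0"
    using eq by simp
  then have "g \<bullet> ?w = 0"
    by simp
  then show ?thesis
    by (simp add: inner_diff_right algebra_simps)
qed

theorem theoremA1:
  fixes L \<eta> :: real
    and loss :: "real ^ 'n ^ 'm \<Rightarrow> real"
    and grad :: "real ^ 'n ^ 'm \<Rightarrow> real ^ 'n ^ 'm"
    and W :: "real ^ 'n ^ 'm"
    and A :: "real ^ 'r ^ 'm"
    and B :: "real ^ 'r ^ 'n"
  assumes "L > 0" and "\<eta> > 0"
    and "\<And>X. GDERIV loss X :> grad X"
    and "\<And>X Y. norm (grad X - grad Y) \<le> L * norm (X - Y)"
    and "norm (transpose A ** grad W) * norm (grad W ** B) \<noteq> 0"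
  defines "G \<equiv> grad W"
  shows
    "\<comment> \<open>first case\<close>
     ((C_A G A B > 0 \<and> C_B G A B \<le> 0) \<or> (C_AB G A B = 0 \<and> A \<noteq> 0) \<longrightarrow>
       (\<forall>s \<in> {1, -1}. is_global_min (scaling_objective L \<eta> G A B)
          (s * (norm (transpose A ** G) / (sqrt (L * \<eta>) * norm (A ** transpose A ** G))), 0)))
     \<and> \<comment> \<open>second case\<close>
     ((C_A G A B \<le> 0 \<and> C_B G A B > 0) \<or> (C_AB G A B = 0 \<and> B \<noteq> 0) \<longrightarrow>
       (\<forall>s \<in> {1, -1}. is_global_min (scaling_objective L \<eta> G A B)
          (0, s * (norm (G ** B) / (sqrt (L * \<eta>) * norm (G ** B ** transpose B))))))
     \<and> \<comment> \<open>third case\<close>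
     (C_A G A B \<ge> 0 \<and> C_B G A B \<ge> 0 \<and> C_AB G A B > 0 \<longrightarrow>
       (\<forall>s \<in> {1, -1}. \<forall>s' \<in> {1, -1}. is_global_min (scaling_objective L \<eta> G A B)
          (s * sqrt (C_A G A B / (L * \<eta> * C_AB G A B)),
           s' * sqrt (C_B G A B / (L * \<eta> * C_AB G A B)))))
     \<and> \<comment> \<open>at least one of the cases applies\<close>
     ((C_A G A B > 0 \<and> C_B G A B \<le> 0) \<or> (C_AB G A B = 0 \<and> A \<noteq> 0)
      \<or> (C_A G A B \<le> 0 \<and> C_B G A B > 0) \<or> (C_AB G A B = 0 \<and> B \<noteq> 0)
      \<or> (C_A G A B \<ge> 0 \<and> C_B G A B \<ge> 0 \<and> C_AB G A B > 0))"
proof -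
  let ?U = "A ** transpose A ** G" and ?V = "G ** B ** transpose B"
  define a where "a = G \<bullet> ?U"
  define b where "b = G \<bullet> ?V"
  define c where "c = ?U \<bullet> ?V"
  define p where "p = ?U \<bullet> ?U"
  define q where "q = ?V \<bullet> ?V"
  have a: "(norm (transpose A ** G))\<^sup>2 = a"
    by (simp add: a_def power2_norm_eq_inner inner_matrix_mult_left matrix_mul_assoc)
  have b: "(norm (G ** B))\<^sup>2 = b"
    by (simp add: b_def power2_norm_eq_inner inner_matrix_mult_right)
  have c: "(norm (transpose A ** G ** B))\<^sup>2 = c"
  proof -
    have "c = (A ** (transpose A ** G)) \<bullet> (G ** B ** transpose B)"
      by (simp add: c_def matrix_mul_assoc)
    also have "\<dots> = (transpose A ** G) \<bullet> ((transpose A ** G ** B) ** transpose B)"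
      by (subst inner_matrix_mult_left) (simp add: matrix_mul_assoc)
    also have "\<dots> = (transpose A ** G ** B) \<bullet> (transpose A ** G ** B)"
      by (simp only: inner_matrix_mult_right)
    finally show ?thesis
      by (simp add: power2_norm_eq_inner)
  qed
  have p: "(norm ?U)\<^sup>2 = p" and q: "(norm ?V)\<^sup>2 = q"
    by (simp_all add: p_def q_def power2_norm_eq_inner)
  have "(norm (transpose A ** G ** B)) ^ 4 = c\<^sup>2"
    by (simp flip: c)
  then have CA: "C_A G A B = a * q - b * c" and CB: "C_B G A B = b * p - a * c"
    and C: "C_AB G A B = p * q - c\<^sup>2"
    by (simp_all add: C_A_def C_B_def C_AB_def a b c p q)
  have pos: "a > 0" "b > 0"
    using assms(5) by (auto simp: G_def simp flip: a b)
  have "?U \<noteq> 0" "?V \<noteq> 0"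
    using pos by (auto simp: a_def b_def)
  then have "p > 0" "q > 0"
    by (simp_all add: p_def q_def)
  have "c \<ge> 0"
    by (simp flip: c)
  have nz: "A \<noteq> 0" "B \<noteq> 0"
    using pos by (auto simp: a_def b_def)
  have C_nonneg: "p * q - c\<^sup>2 \<ge> 0"
    using Cauchy_Schwarz_ineq[of ?U ?V] by (simp add: p_def q_def c_def)
  \<comment> \<open>When the Gram determinant vanishes, \<open>?U\<close> and \<open>?V\<close> are
    parallel and span a single ray, so the optimum along either generator is already global.\<close>
  have degenerate: "a * q - b * c = 0" "b * p - a * c = 0" if "p * q - c\<^sup>2 = 0"
    using inner_proportional_if_Cauchy_Schwarz_eq[of ?U ?V G]
      inner_proportional_if_Cauchy_Schwarz_eq[of ?V ?U G] that
    by (simp_all add: a_def b_def c_def p_def q_def inner_commute mult.commute)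
  \<comment> \<open>\<open>x\<close> and \<open>y\<close> are the coefficients of \<open>?U\<close>
    and \<open>?V\<close> in the approximant; the two bounded expressions are the inner products of
    the residual with \<open>?U\<close> and \<open>?V\<close>.\<close>
  have minI: "is_global_min (scaling_objective L \<eta> G A B) (\<alpha>, \<beta>)"
    if "\<eta> * \<alpha>\<^sup>2 = x" "\<eta> * \<beta>\<^sup>2 = y"
      and "a / L - y * c - x * p \<le> 0" "b / L - y * q - x * c \<le> 0"
      and "x = 0 \<or> a / L - y * c - x * p = 0" "y = 0 \<or> b / L - y * q - x * c = 0"
    for \<alpha> \<beta> x y
  proof -
    define R where "R = (1 / L) *\<^sub>R G - (\<eta> * \<beta>\<^sup>2) *\<^sub>R ?V - (\<eta> * \<alpha>\<^sup>2) *\<^sub>R ?U"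
    have "R \<bullet> ?U = a / L - y * c - x * p" "R \<bullet> ?V = b / L - y * q - x * c"
      by (simp_all add: R_def that(1,2) a_def b_def c_def p_def q_def inner_diff_left
          inner_commute[of ?V ?U])
    then show ?thesis
      using that \<open>\<eta> > 0\<close> by (intro scaling_objective_global_minI[OF assms(1,2) R_def]) auto
  qed
  \<comment> \<open>On the ray \<open>y = 0\<close>, orthogonality to \<open>?U\<close> forces
    \<open>x = a / (L * p)\<close>; nonpositivity against \<open>?V\<close> then reads
    \<open>b * p - a * c \<le> 0\<close>.\<close>
  have first: "is_global_min (scaling_objective L \<eta> G A B)
          (s * (norm (transpose A ** G) / (sqrt (L * \<eta>) * norm ?U)), 0)"
    if "b * p - a * c \<le> 0" "s \<in> {1, -1}" for s
  proof (rule minI)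
    show "\<eta> * (s * (norm (transpose A ** G) / (sqrt (L * \<eta>) * norm ?U)))\<^sup>2 = a / (L * p)"
      using that(2) assms(1,2) by (auto simp: power_divide power_mult_distrib a p)
    show "b / L - 0 * q - a / (L * p) * c \<le> 0"
      using that(1) \<open>p > 0\<close> \<open>L > 0\<close> by (simp add: field_simps)
  qed (use \<open>p > 0\<close> in auto)
  have second: "is_global_min (scaling_objective L \<eta> G A B)
          (0, s * (norm (G ** B) / (sqrt (L * \<eta>) * norm ?V)))"
    if "a * q - b * c \<le> 0" "s \<in> {1, -1}" for s
  proof (rule minI)
    show "\<eta> * (s * (norm (G ** B) / (sqrt (L * \<eta>) * norm ?V)))\<^sup>2 = b / (L * q)"
      using that(2) assms(1,2) by (auto simp: power_divide power_mult_distrib b q)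
    show "a / L - b / (L * q) * c - 0 * p \<le> 0"
      using that(1) \<open>q > 0\<close> \<open>L > 0\<close> by (simp add: field_simps)
  qed (use \<open>q > 0\<close> in auto)
  have third: "is_global_min (scaling_objective L \<eta> G A B)
          (s * sqrt ((a * q - b * c) / (L * \<eta> * (p * q - c\<^sup>2))),
           s' * sqrt ((b * p - a * c) / (L * \<eta> * (p * q - c\<^sup>2))))"
    if "a * q - b * c \<ge> 0" "b * p - a * c \<ge> 0" "p * q - c\<^sup>2 > 0" "s \<in> {1, -1}" "s' \<in> {1, -1}"
    for s s'
  proof -
    define D where "D = p * q - c\<^sup>2"
    have "D > 0"
      using that(3) by (simp add: D_def)
    \<comment> \<open>Cramer's rule for the normal equations \<open>x * p + y * c = a / L\<close>
      and \<open>x * c + y * q = b / L\<close>, whose determinant is \<open>D\<close>.\<close>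
    let ?x = "(a * q - b * c) / (L * D)" and ?y = "(b * p - a * c) / (L * D)"
    have sq: "\<eta> * (t * sqrt (z / (L * \<eta> * D)))\<^sup>2 = z / (L * D)" if "z \<ge> 0" "t \<in> {1, -1}" for z t
      using that assms(1,2) \<open>D > 0\<close> by (auto simp: power_mult_distrib)
    have "(b * p - a * c) * c + (a * q - b * c) * p = a * D"
      by (simp add: D_def power2_eq_square algebra_simps)
    then have "?y * c + ?x * p = a / L"
      using \<open>D > 0\<close> by (simp flip: add_divide_distrib)
    moreover have "(b * p - a * c) * q + (a * q - b * c) * c = b * D"
      by (simp add: D_def power2_eq_square algebra_simps)
    then have "?y * q + ?x * c = b / L"
      using \<open>D > 0\<close> by (simp flip: add_divide_distrib)
    ultimately have stat: "a / L - ?y * c - ?x * p = 0" "b / L - ?y * q - ?x * c = 0"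
      by linarith+
    show ?thesis
      unfolding D_def[symmetric]
      by (rule minI[OF sq sq]) (use that stat in simp_all)
  qed
  \<comment> \<open>Excludes the sign pattern that no case covers: were both nonpositive,
    multiplying \<open>a * q \<le> b * c\<close> by \<open>b * p \<le> a * c\<close> would give
    \<open>p * q \<le> c\<^sup>2\<close>.\<close>
  have some_pos: "a * q - b * c > 0 \<or> b * p - a * c > 0" if "p * q - c\<^sup>2 > 0"
  proof (rule ccontr)
    assume "\<not> ?thesis"
    then have "(a * q) * (b * p) \<le> (b * c) * (a * c)"
      using pos \<open>p > 0\<close> \<open>c \<ge> 0\<close> by (intro mult_mono[of "a * q" "b * c" "b * p" "a * c"]) auto
    then have "(a * b) * (p * q) \<le> (a * b) * c\<^sup>2"
      by (simp add: power2_eq_square mult_ac)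
    then show False
      using pos that by simp
  qed
  show ?thesis
    unfolding CA CB C
  proof (intro conjI impI ballI, goal_cases)
    case 4
    have "p * q - c\<^sup>2 = 0 \<or> p * q - c\<^sup>2 > 0"
      using C_nonneg by linarith
    then show ?case
      using some_pos nz by (meson leI less_imp_le)
  \<comment> \<open>In the first two cases, \<open>degenerate\<close> turns the alternative
    \<open>p * q - c\<^sup>2 = 0\<close> into the weak inequality that \<open>first\<close> or
    \<open>second\<close> asks for.\<close>
  qed (rule first second third; use degenerate in auto)+
qed

end
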